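(* There is no chordal graph $G$ such that the reduced clique graph $C_R(G)$ has an induced cycle with exactly five vertices.
   Context: All graphs are finite and simple. A graph is chordal if every cycle with at least four vertices has a chord (an edge joining two vertices of the cycle that is not in the cycle). A clique is a set of pairwise adjacent vertices; maximal cliques are maximal with respect to inclusion. For a set $S$ of vertices, a path is $S$-avoiding if no internal vertex of the path is in $S$. The reduced clique graph $C_R(G)$ of a chordal graph $G$ has the maximal cliques of $G$ as its vertices; distinct maximal cliques $C$ and $C'$ are adjacent in $C_R(G)$ if and only if $C\cap C'\neq\emptyset$ and $C,C'$ form a separating pair, meaning that there is no $(C\cap C')$-avoiding path of $G$ from a vertex in $C-C'$ to a vertex in $C'-C$. *)

theory Defs
  imports Main
begin

text \<open>A graph is given by its vertex set and its set of edges, an edge being the two-element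
  set of its ends.\<close>

definition finite_simple_graph :: "'a set \<Rightarrow> 'a set set \<Rightarrow> bool" where
  "finite_simple_graph V E \<longleftrightarrow> finite V \<and> (\<forall>e\<in>E. e \<subseteq> V \<and> card e = 2)"

definition is_path :: "'a set \<Rightarrow> 'a set set \<Rightarrow> 'a list \<Rightarrow> bool" where
  "is_path V E p \<longleftrightarrow>
     p \<noteq> [] \<and> distinct p \<and> set p \<subseteq> V \<and> successively (\<lambda>u v. {u, v} \<in> E) p"

definition internal_vertices :: "'a list \<Rightarrow> 'a set" where
  "internal_vertices p = set (butlast (tl p))"

definition avoiding :: "'a set \<Rightarrow> 'a list \<Rightarrow> bool" where
  "avoiding S p \<longleftrightarrow> internal_vertices p \<inter> S = {}"

text \<open>A cycle is listed once around, without repeating its first vertex at the end.\<close>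

definition cycle_edges :: "'a list \<Rightarrow> 'a set set" where
  "cycle_edges c = {{c ! i, c ! (Suc i mod length c)} | i. i < length c}"

definition is_cycle :: "'a set \<Rightarrow> 'a set set \<Rightarrow> 'a list \<Rightarrow> bool" where
  "is_cycle V E c \<longleftrightarrow>
     3 \<le> length c \<and> distinct c \<and> set c \<subseteq> V \<and> cycle_edges c \<subseteq> E"

definition is_chord :: "'a set set \<Rightarrow> 'a list \<Rightarrow> 'a set \<Rightarrow> bool" where
  "is_chord E c e \<longleftrightarrow> e \<in> E \<and> e \<subseteq> set c \<and> e \<notin> cycle_edges c"

definition chordal :: "'a set \<Rightarrow> 'a set set \<Rightarrow> bool" where
  "chordal V E \<longleftrightarrow> (\<forall>c. is_cycle V E c \<and> 4 \<le> length c \<longrightarrow> (\<exists>e. is_chord E c e))"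

definition induced_edges :: "'a set set \<Rightarrow> 'a set \<Rightarrow> 'a set set" where
  "induced_edges E S = {e \<in> E. e \<subseteq> S}"

definition induced_cycle :: "'a set \<Rightarrow> 'a set set \<Rightarrow> 'a list \<Rightarrow> bool" where
  "induced_cycle V E c \<longleftrightarrow> is_cycle V E c \<and> induced_edges E (set c) = cycle_edges c"

definition clique :: "'a set \<Rightarrow> 'a set set \<Rightarrow> 'a set \<Rightarrow> bool" where
  "clique V E C \<longleftrightarrow> C \<subseteq> V \<and> (\<forall>u\<in>C. \<forall>v\<in>C. u \<noteq> v \<longrightarrow> {u, v} \<in> E)"

definition maximal_cliques :: "'a set \<Rightarrow> 'a set set \<Rightarrow> 'a set set" where
  "maximal_cliques V E = {C. clique V E C \<and> (\<forall>D. clique V E D \<and> C \<subseteq> D \<longrightarrow> D = C)}"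

definition separating_pair :: "'a set \<Rightarrow> 'a set set \<Rightarrow> 'a set \<Rightarrow> 'a set \<Rightarrow> bool" where
  "separating_pair V E C C' \<longleftrightarrow>
     \<not> (\<exists>p. is_path V E p \<and> hd p \<in> C - C' \<and> last p \<in> C' - C \<and> avoiding (C \<inter> C') p)"

text \<open>The reduced clique graph has vertex set \<^term>\<open>maximal_cliques V E\<close> and the following
  edges.\<close>

definition reduced_clique_edges :: "'a set \<Rightarrow> 'a set set \<Rightarrow> 'a set set set" where
  "reduced_clique_edges V E =
     {{C, C'} | C C'. C \<in> maximal_cliques V E \<and> C' \<in> maximal_cliques V E \<and> C \<noteq> C' \<and>
        C \<inter> C' \<noteq> {} \<and> separating_pair V E C C'}"

lemma finite_simple_graph_reduced_clique_graph:
  assumes "finite_simple_graph V E"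
  shows "finite_simple_graph (maximal_cliques V E) (reduced_clique_edges V E)"
proof -
  have "maximal_cliques V E \<subseteq> Pow V"
    by (auto simp: maximal_cliques_def clique_def)
  then have "finite (maximal_cliques V E)"
    using assms by (meson finite_Pow_iff finite_simple_graph_def finite_subset)
  then show ?thesis
    by (auto simp: finite_simple_graph_def reduced_clique_edges_def card_2_iff)
qed

end

theory Submission
  imports Defs
begin

text \<open>Fix five maximal cliques that form an induced cycle of the reduced clique graph, and label
  each of the five cycle edges with the intersection of its two ends. Two observations about how
  labels contain one another lead to a contradiction.

  First, walk from one end of an edge with label \<open>S\<close> to the other end along the four remaining
  edges. Since \<open>S\<close> separates the two ends, consecutive cliques on the way cannot always share a
  vertex outside \<open>S\<close>; so the label of some other edge is contained in \<open>S\<close>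
  (\<open>label_contains_another_label\<close>).

  Secondly, each edge has exactly one opposite clique, the one adjacent to neither end. It cannot
  contain the label \<open>S\<close> of that edge: two non-adjacent cliques that share \<open>S\<close> are joined
  by a path outside their intersection, hence outside \<open>S\<close>, so the opposite clique would connect
  the two ends outside \<open>S\<close> (\<open>label_not_within_opposite_clique\<close>).

  By the second observation, the label found in the first one belongs to one of the two neighbouring
  edges, and inclusions of labels cannot be composed along two consecutive steps around the cycle.
  Thus if the label of an edge contains the label of a neighbour, then the latter can only contain
  the former in return. The five edges would be matched up in pairs, but five is odd
  (\<open>five_cyclic_sets_impossible\<close>).

  Separation is handled by reachability in the graph with \<open>S\<close> removed: all vertices of a clique
  outside \<open>S\<close> reach one another there, so chains of cliques can be glued together.\<close>

section \<open>Reachability outside a vertex set\<close>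

definition edge_outside :: "'a set set \<Rightarrow> 'a set \<Rightarrow> 'a \<Rightarrow> 'a \<Rightarrow> bool" where
  "edge_outside E S u v \<longleftrightarrow> {u, v} \<in> E \<and> u \<notin> S \<and> v \<notin> S"

definition linked_outside :: "'a set set \<Rightarrow> 'a set \<Rightarrow> 'a set \<Rightarrow> 'a set \<Rightarrow> bool" where
  "linked_outside E S A B \<longleftrightarrow> (\<exists>a\<in>A - S. \<exists>b\<in>B - S. (edge_outside E S)\<^sup>*\<^sup>* a b)"

lemma reachable_outside_sym:
  assumes "(edge_outside E S)\<^sup>*\<^sup>* u v"
  shows "(edge_outside E S)\<^sup>*\<^sup>* v u"
proof -
  have "symp (edge_outside E S)"
    by (auto simp: edge_outside_def insert_commute intro: sympI)
  then show ?thesis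
    using assms by (metis symp_rtranclp sympD)
qed

lemma linked_outside_sym: "linked_outside E S A B \<Longrightarrow> linked_outside E S B A"
  unfolding linked_outside_def using reachable_outside_sym by fastforce

lemma linked_outside_antimono:
  assumes "linked_outside E T A B" "S \<subseteq> T"
  shows "linked_outside E S A B"
proof -
  have "edge_outside E T \<le> edge_outside E S"
    using assms(2) by (auto simp: edge_outside_def)
  then have "(edge_outside E T)\<^sup>*\<^sup>* \<le> (edge_outside E S)\<^sup>*\<^sup>*"
    by (rule rtranclp_mono)
  then show ?thesis
    using assms unfolding linked_outside_def by blast
qed

lemma linked_outside_trans:
  assumes "clique V E B" "linked_outside E S A B" "linked_outside E S B C"
  shows "linked_outside E S A C"
proof -
  obtain a b where ab: "a \<in> A - S" "b \<in> B - S" "(edge_outside E S)\<^sup>*\<^sup>* a b"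
    using assms(2) unfolding linked_outside_def by blast
  obtain b' c where bc: "b' \<in> B - S" "c \<in> C - S" "(edge_outside E S)\<^sup>*\<^sup>* b' c"
    using assms(3) unfolding linked_outside_def by blast
  have "(edge_outside E S)\<^sup>*\<^sup>* b b'"
  proof (cases "b = b'")
    case False
    then have "edge_outside E S b b'"
      using assms(1) ab(2) bc(1) by (auto simp: clique_def edge_outside_def)
    then show ?thesis by blast
  qed simp
  then show ?thesis
    using ab bc unfolding linked_outside_def by (meson rtranclp_trans)
qed

lemma linked_outside_if_meet_outside:
  "\<not> A \<inter> B \<subseteq> S \<Longrightarrow> linked_outside E S A B"
  unfolding linked_outside_def by blast

section \<open>Separating pairs in terms of reachability\<close>

lemma reachable_if_path_outside:
  assumes "successively (\<lambda>u v. {u, v} \<in> E) p" "p \<noteq> []" "set p \<inter> S = {}"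
  shows "(edge_outside E S)\<^sup>*\<^sup>* (hd p) (last p)"
  using assms
proof (induction p rule: induct_list012)
  case (3 x y zs)
  then have "edge_outside E S x y"
    by (auto simp: edge_outside_def)
  moreover have "(edge_outside E S)\<^sup>*\<^sup>* y (last (y # zs))"
    using 3 by auto
  ultimately show ?case
    by (simp add: converse_rtranclp_into_rtranclp)
qed auto

lemma path_outside_if_reachable:
  assumes "finite_simple_graph V E" "u \<in> V - S" "(edge_outside E S)\<^sup>*\<^sup>* u v"
  shows "\<exists>p. is_path V E p \<and> hd p = u \<and> last p = v \<and> set p \<inter> S = {}"
  using assms(3)
proof (induction rule: rtranclp_induct)
  case base
  have "is_path V E [u]"
    using assms(2) by (simp add: is_path_def)
  then show ?case
    using assms(2) by (intro exI[of _ "[u]"]) auto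
next
  case (step y z)
  then obtain p where p: "is_path V E p" "hd p = u" "last p = y" "set p \<inter> S = {}"
    by blast
  show ?case
  proof (cases "z \<in> set p")
    case True
    \<comment> \<open>A path has no repeated vertices, so it is cut off at \<open>z\<close> instead of being extended.\<close>
    then obtain xs ys where split: "p = (xs @ [z]) @ ys"
      by (metis append.assoc append_Cons append_Nil split_list)
    have "is_path V E (xs @ [z])"
      using p(1) unfolding split is_path_def by (auto simp: successively_append_iff)
    moreover have "hd (xs @ [z]) = u"
      using p(2) unfolding split by (cases xs) auto
    ultimately show ?thesis
      using p(4) unfolding split by (intro exI[of _ "xs @ [z]"]) auto
  next
    case False
    have "{y, z} \<in> E" "z \<notin> S"
      using step.hyps by (auto simp: edge_outside_def)
    moreover have "z \<in> V"
      using \<open>{y, z} \<in> E\<close> assms(1) by (auto simp: finite_simple_graph_def)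
    ultimately have "is_path V E (p @ [z])"
      using p False by (auto simp: is_path_def successively_append_iff)
    moreover have "hd (p @ [z]) = u"
      using p by (auto simp: is_path_def)
    ultimately show ?thesis
      using p(4) \<open>z \<notin> S\<close> by (intro exI[of _ "p @ [z]"]) auto
  qed
qed

lemma set_subset_ends_and_internal_vertices:
  "set p \<subseteq> {hd p, last p} \<union> internal_vertices p"
proof (cases p)
  case (Cons x xs)
  then show ?thesis
    by (cases xs rule: rev_cases) (auto simp: internal_vertices_def)
qed simp

lemma internal_vertices_subset: "internal_vertices p \<subseteq> set p"
  by (cases p) (auto simp: internal_vertices_def dest: in_set_butlastD)

lemma separating_pair_iff_not_linked:
  assumes "finite_simple_graph V E" "clique V E C"
  shows "separating_pair V E C C' \<longleftrightarrow> \<not> linked_outside E (C \<inter> C') C C'"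
proof
  assume sep: "separating_pair V E C C'"
  show "\<not> linked_outside E (C \<inter> C') C C'"
  proof
    assume "linked_outside E (C \<inter> C') C C'"
    then obtain a b where ab: "a \<in> C - C \<inter> C'" "b \<in> C' - C \<inter> C'"
      "(edge_outside E (C \<inter> C'))\<^sup>*\<^sup>* a b"
      unfolding linked_outside_def by blast
    have "a \<in> V - C \<inter> C'"
      using ab(1) assms(2) by (auto simp: clique_def)
    then obtain p where p: "is_path V E p" "hd p = a" "last p = b" "set p \<inter> (C \<inter> C') = {}"
      using path_outside_if_reachable[OF assms(1)] ab(3) by blast
    then have "avoiding (C \<inter> C') p"
      using internal_vertices_subset[of p] unfolding avoiding_def by blast
    then show False
      using sep p ab unfolding separating_pair_def by blast
  qed
next
  assume not_linked: "\<not> linked_outside E (C \<inter> C') C C'"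
  show "separating_pair V E C C'"
    unfolding separating_pair_def
  proof
    assume "\<exists>p. is_path V E p \<and> hd p \<in> C - C' \<and> last p \<in> C' - C \<and> avoiding (C \<inter> C') p"
    then obtain p where p: "is_path V E p" "hd p \<in> C - C'" "last p \<in> C' - C"
      "avoiding (C \<inter> C') p"
      by blast
    have "set p \<inter> (C \<inter> C') = {}"
      using set_subset_ends_and_internal_vertices[of p] p(2-4) unfolding avoiding_def by blast
    then have "(edge_outside E (C \<inter> C'))\<^sup>*\<^sup>* (hd p) (last p)"
      using p(1) reachable_if_path_outside unfolding is_path_def by blast
    then show False
      using not_linked p(2,3) unfolding linked_outside_def by blast
  qed
qed

lemma reduced_clique_edge_iff:
  assumes "finite_simple_graph V E" "C \<in> maximal_cliques V E" "D \<in> maximal_cliques V E" "C \<noteq> D"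
  shows "{C, D} \<in> reduced_clique_edges V E \<longleftrightarrow>
    C \<inter> D \<noteq> {} \<and> \<not> linked_outside E (C \<inter> D) C D"
proof -
  have "clique V E C" "clique V E D"
    using assms(2,3) by (auto simp: maximal_cliques_def)
  then have "separating_pair V E C D \<longleftrightarrow> \<not> linked_outside E (C \<inter> D) C D"
    and "separating_pair V E D C \<longleftrightarrow> \<not> linked_outside E (C \<inter> D) C D"
    using separating_pair_iff_not_linked[OF assms(1)] linked_outside_sym
    by (metis Int_commute)+
  then show ?thesis
    using assms(2-4) unfolding reduced_clique_edges_def by (auto simp: doubleton_eq_iff)
qed

section \<open>Labels on an induced five-cycle\<close>

text \<open>Otherwise each of the four intersections has a vertex outside \<open>A \<inter> B\<close>, and
  walks inside \<open>C\<close>, \<open>D\<close> and \<open>F\<close> between these vertices connect \<open>B\<close> to \<open>A\<close> outside \<open>A \<inter> B\<close>.\<close>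

lemma label_contains_another_label:
  assumes "\<not> linked_outside E (A \<inter> B) A B" "clique V E C" "clique V E D" "clique V E F"
  shows "B \<inter> C \<subseteq> A \<inter> B \<or> C \<inter> D \<subseteq> A \<inter> B \<or> D \<inter> F \<subseteq> A \<inter> B \<or> F \<inter> A \<subseteq> A \<inter> B"
proof (rule ccontr)
  assume "\<not> ?thesis"
  then have "linked_outside E (A \<inter> B) B C" "linked_outside E (A \<inter> B) C D"
    "linked_outside E (A \<inter> B) D F" "linked_outside E (A \<inter> B) F A"
    by (simp_all add: linked_outside_if_meet_outside)
  then have "linked_outside E (A \<inter> B) B A"
    using assms(2-4) by (meson linked_outside_trans)
  then show False
    using assms(1) linked_outside_sym by blast
qed

text \<open>If \<open>D\<close> contained \<open>A \<inter> B\<close>, it would share that set with both ends. Links outside the larger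
  sets \<open>A \<inter> D\<close> and \<open>B \<inter> D\<close>, which non-adjacency provides, are then links outside \<open>A \<inter> B\<close>.\<close>

lemma label_not_within_opposite_clique:
  assumes "\<not> linked_outside E (A \<inter> B) A B" "A \<inter> B \<noteq> {}" "clique V E D"
    and A: "A \<inter> D \<noteq> {} \<Longrightarrow> linked_outside E (A \<inter> D) A D"
    and B: "B \<inter> D \<noteq> {} \<Longrightarrow> linked_outside E (B \<inter> D) B D"
  shows "\<not> A \<inter> B \<subseteq> D"
proof
  assume sub: "A \<inter> B \<subseteq> D"
  have "linked_outside E (A \<inter> B) A D"
    using A assms(2) sub linked_outside_antimono[of E "A \<inter> D" A D "A \<inter> B"] by blast
  moreover have "linked_outside E (A \<inter> B) B D"
    using B assms(2) sub linked_outside_antimono[of E "B \<inter> D" B D "A \<inter> B"] by blast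
  ultimately show False
    using assms(1,3) linked_outside_sym linked_outside_trans by metis
qed

text \<open>The sets are listed in cyclic order. An inclusion of the label of \<open>B C\<close> in that of \<open>A B\<close>
  propagates around the cycle: it forces the label of \<open>B C\<close> to contain that of \<open>A B\<close>, then the
  labels of \<open>C D\<close> and \<open>D F\<close> to contain each other, and the label of \<open>F A\<close> can contain neither
  that of \<open>A B\<close> nor that of \<open>D F\<close>, because two inclusions would compose.\<close>

lemma no_label_contains_next_label:
  assumes opposite: "\<not> A \<inter> B \<subseteq> D" "\<not> B \<inter> C \<subseteq> F" "\<not> C \<inter> D \<subseteq> A" "\<not> F \<inter> A \<subseteq> C"
    and neighbour: "C \<inter> D \<subseteq> B \<inter> C \<or> A \<inter> B \<subseteq> B \<inter> C" "D \<inter> F \<subseteq> C \<inter> D \<or> B \<inter> C \<subseteq> C \<inter> D"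
      "F \<inter> A \<subseteq> D \<inter> F \<or> C \<inter> D \<subseteq> D \<inter> F" "A \<inter> B \<subseteq> F \<inter> A \<or> D \<inter> F \<subseteq> F \<inter> A"
  shows "\<not> B \<inter> C \<subseteq> A \<inter> B"
proof
  assume "B \<inter> C \<subseteq> A \<inter> B"
  then have AB: "A \<inter> B \<subseteq> B \<inter> C" using neighbour(1) opposite(3) by auto
  then have DF: "D \<inter> F \<subseteq> C \<inter> D" using neighbour(2) opposite(1) by auto
  then have CD: "C \<inter> D \<subseteq> D \<inter> F" using neighbour(3) opposite(4) by auto
  show False
    using neighbour(4) \<open>B \<inter> C \<subseteq> A \<inter> B\<close> CD opposite(2,3) by auto
qed

text \<open>The assumptions \<open>opposite\<close> rule out every inclusion between the labels of two disjoint
  edges, so each label contains that of a neighbouring edge.\<close>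

lemma five_cyclic_sets_impossible:
  assumes contains: "B \<inter> C \<subseteq> A \<inter> B \<or> C \<inter> D \<subseteq> A \<inter> B \<or> D \<inter> F \<subseteq> A \<inter> B \<or> F \<inter> A \<subseteq> A \<inter> B"
      "C \<inter> D \<subseteq> B \<inter> C \<or> D \<inter> F \<subseteq> B \<inter> C \<or> F \<inter> A \<subseteq> B \<inter> C \<or> A \<inter> B \<subseteq> B \<inter> C"
      "D \<inter> F \<subseteq> C \<inter> D \<or> F \<inter> A \<subseteq> C \<inter> D \<or> A \<inter> B \<subseteq> C \<inter> D \<or> B \<inter> C \<subseteq> C \<inter> D"
      "F \<inter> A \<subseteq> D \<inter> F \<or> A \<inter> B \<subseteq> D \<inter> F \<or> B \<inter> C \<subseteq> D \<inter> F \<or> C \<inter> D \<subseteq> D \<inter> F"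
      "A \<inter> B \<subseteq> F \<inter> A \<or> B \<inter> C \<subseteq> F \<inter> A \<or> C \<inter> D \<subseteq> F \<inter> A \<or> D \<inter> F \<subseteq> F \<inter> A"
    and opposite: "\<not> A \<inter> B \<subseteq> D" "\<not> B \<inter> C \<subseteq> F" "\<not> C \<inter> D \<subseteq> A" "\<not> D \<inter> F \<subseteq> B" "\<not> F \<inter> A \<subseteq> C"
  shows False
proof -
  have neighbour: "B \<inter> C \<subseteq> A \<inter> B \<or> F \<inter> A \<subseteq> A \<inter> B" "C \<inter> D \<subseteq> B \<inter> C \<or> A \<inter> B \<subseteq> B \<inter> C"
    "D \<inter> F \<subseteq> C \<inter> D \<or> B \<inter> C \<subseteq> C \<inter> D" "F \<inter> A \<subseteq> D \<inter> F \<or> C \<inter> D \<subseteq> D \<inter> F"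
    "A \<inter> B \<subseteq> F \<inter> A \<or> D \<inter> F \<subseteq> F \<inter> A"
    using contains opposite by simp_all
  have "\<not> B \<inter> C \<subseteq> A \<inter> B"
    using no_label_contains_next_label[of A B D C F] neighbour opposite by blast
  moreover have "\<not> A \<inter> F \<subseteq> B \<inter> A"
    \<comment> \<open>the same cycle, listed backwards from \<open>B\<close>\<close>
    using no_label_contains_next_label[of B A D F C] neighbour opposite
    by (simp add: Int_commute disj_commute)
  ultimately show False
    using neighbour(1) by (simp add: Int_commute)
qed

theorem lemma3p8:
  "\<not> (\<exists>(V :: 'a set) E. finite_simple_graph V E \<and> chordal V E \<and>
        (\<exists>c. induced_cycle (maximal_cliques V E) (reduced_clique_edges V E) c \<and> length c = 5))"
proof
  assume "\<exists>(V :: 'a set) E. finite_simple_graph V E \<and> chordal V E \<and>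
        (\<exists>c. induced_cycle (maximal_cliques V E) (reduced_clique_edges V E) c \<and> length c = 5)"
  then obtain V :: "'a set" and E c where graph: "finite_simple_graph V E"
    and c: "induced_cycle (maximal_cliques V E) (reduced_clique_edges V E) c" "length c = 5"
    by blast
  obtain A B C D F where list: "c = [A, B, C, D, F]"
    using c(2) by (auto simp: eval_nat_numeral length_Suc_conv)
  let ?R = "reduced_clique_edges V E"
  have five: "{i. i < (5::nat)} = {0, 1, 2, 3, 4}"
    by auto
  have "cycle_edges c = (\<lambda>i. {c ! i, c ! (Suc i mod 5)}) ` {i. i < (5::nat)}"
    unfolding cycle_edges_def c(2) by auto
  then have cycle: "cycle_edges c = {{A, B}, {B, C}, {C, D}, {D, F}, {F, A}}"
    unfolding five list by simp
  have is_cycle: "is_cycle (maximal_cliques V E) ?R c"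
    and edges: "{e \<in> ?R. e \<subseteq> set c} = cycle_edges c"
    using c(1) by (simp_all add: induced_cycle_def induced_edges_def)
  have set: "set c = {A, B, C, D, F}"
    by (simp add: list)
  have distinct: "distinct [A, B, C, D, F]"
    using is_cycle by (simp only: is_cycle_def list)
  have maximal: "{A, B, C, D, F} \<subseteq> maximal_cliques V E"
    and cycle_in: "cycle_edges c \<subseteq> ?R"
    using is_cycle unfolding is_cycle_def set by blast+
  have induced: "e \<in> cycle_edges c" if "e \<in> ?R" "e \<subseteq> {A, B, C, D, F}" for e
    using that unfolding edges[symmetric] set by blast
  have cliques: "clique V E A" "clique V E B" "clique V E C" "clique V E D" "clique V E F"
    using maximal by (auto simp: maximal_cliques_def)
  have edge_iff: "{X, Y} \<in> ?R \<longleftrightarrow> X \<inter> Y \<noteq> {} \<and> \<not> linked_outside E (X \<inter> Y) X Y"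
    if "X \<in> {A, B, C, D, F}" "Y \<in> {A, B, C, D, F}" "X \<noteq> Y" for X Y
    using that maximal by (intro reduced_clique_edge_iff[OF graph]) auto

  have "{A, B} \<in> ?R" "{B, C} \<in> ?R" "{C, D} \<in> ?R" "{D, F} \<in> ?R" "{F, A} \<in> ?R"
    using cycle_in cycle by auto
  then have nonempty: "A \<inter> B \<noteq> {}" "B \<inter> C \<noteq> {}" "C \<inter> D \<noteq> {}" "D \<inter> F \<noteq> {}" "F \<inter> A \<noteq> {}"
    and separated: "\<not> linked_outside E (A \<inter> B) A B" "\<not> linked_outside E (B \<inter> C) B C"
      "\<not> linked_outside E (C \<inter> D) C D" "\<not> linked_outside E (D \<inter> F) D F"
      "\<not> linked_outside E (F \<inter> A) F A"
    using edge_iff[of A B] edge_iff[of B C] edge_iff[of C D] edge_iff[of D F] edge_iff[of F A]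
      distinct by (simp_all add: eq_commute[of F A])

  have "{A, C} \<notin> cycle_edges c" "{A, D} \<notin> cycle_edges c" "{B, D} \<notin> cycle_edges c"
    "{B, F} \<notin> cycle_edges c" "{C, F} \<notin> cycle_edges c"
    using distinct unfolding cycle by (auto simp: doubleton_eq_iff)
  then have non_adjacent: "{A, C} \<notin> ?R" "{A, D} \<notin> ?R" "{B, D} \<notin> ?R" "{B, F} \<notin> ?R" "{C, F} \<notin> ?R"
    using induced by (meson empty_subsetI insert_subset insertCI)+
  have linked: "linked_outside E (X \<inter> Y) X Y"
    if "X \<inter> Y \<noteq> {}" "{X, Y} \<notin> ?R" "X \<in> {A, B, C, D, F}" "Y \<in> {A, B, C, D, F}" "X \<noteq> Y" for X Y
    using that edge_iff by blast

  show False
  proof (rule five_cyclic_sets_impossible)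
    show "\<not> A \<inter> B \<subseteq> D" "\<not> B \<inter> C \<subseteq> F" "\<not> C \<inter> D \<subseteq> A" "\<not> D \<inter> F \<subseteq> B" "\<not> F \<inter> A \<subseteq> C"
      by (rule label_not_within_opposite_clique, rule separated, rule nonempty, rule cliques;
          rule linked; use non_adjacent distinct in \<open>auto simp: insert_commute\<close>)+
  qed (rule label_contains_another_label; rule separated cliques)+
qed

end
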